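(* Let $\mathfrak{g}$ be a finite-dimensional Lie algebra over an algebraically closed field $\mathbb{F}$ of characteristic zero and let $G$ be a subgroup of $\mathrm{Aut}(\mathfrak{g})$. For an arbitrary element $\sigma\in G$, there exists a Lie algebra structure $[-,-]_{\sigma}$ on the vector space $\mathrm{Der}_{\sigma,\sigma}(\mathfrak{g})$ such that $\mathrm{Der}_{\sigma,\sigma}(\mathfrak{g})\cong\mathrm{Der}(\mathfrak{g})$ as Lie algebras.
   Context: $\mathrm{Aut}(\mathfrak{g})$ is the group of Lie algebra automorphisms of $\mathfrak{g}$. For $\sigma,\tau\in\mathrm{Aut}(\mathfrak{g})$, $\mathrm{Der}_{\sigma,\tau}(\mathfrak{g})$ is the vector space of all linear maps $D:\mathfrak{g}\to\mathfrak{g}$ such that $D([x,y])=[D(x),\sigma(y)]+[\tau(x),D(y)]$ for all $x,y\in\mathfrak{g}$. $\mathrm{Der}(\mathfrak{g})=\mathrm{Der}_{1,1}(\mathfrak{g})$ is the Lie algebra of derivations of $\mathfrak{g}$ with bracket $[D,T]=D\circ T-T\circ D$. *)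

theory Defs
  imports
    "HOL-Algebra.Group"
    "HOL-Computational_Algebra.Polynomial"
    "HOL-Library.Function_Algebras"
begin

text \<open>A Lie algebra whose underlying vector space is a subspace \<open>L\<close> of an ambient vector space.
  Only the values of the bracket on \<open>L\<close> matter. Taking \<open>L = UNIV\<close> gives a Lie algebra on the
  ambient space itself.\<close>

locale lie_algebra = vector_space scale
  for scale :: "'f::field \<Rightarrow> 'v::ab_group_add \<Rightarrow> 'v" +
  fixes L :: "'v set" and bracket :: "'v \<Rightarrow> 'v \<Rightarrow> 'v"
  assumes subspace_carrier: "subspace L"
    and bracket_closed: "\<lbrakk>x \<in> L; y \<in> L\<rbrakk> \<Longrightarrow> bracket x y \<in> L"
    and bracket_add_left:
      "\<lbrakk>x \<in> L; y \<in> L; z \<in> L\<rbrakk> \<Longrightarrow> bracket (x + y) z = bracket x z + bracket y z"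
    and bracket_add_right:
      "\<lbrakk>x \<in> L; y \<in> L; z \<in> L\<rbrakk> \<Longrightarrow> bracket x (y + z) = bracket x y + bracket x z"
    and bracket_scale_left:
      "\<lbrakk>x \<in> L; y \<in> L\<rbrakk> \<Longrightarrow> bracket (scale c x) y = scale c (bracket x y)"
    and bracket_scale_right:
      "\<lbrakk>x \<in> L; y \<in> L\<rbrakk> \<Longrightarrow> bracket x (scale c y) = scale c (bracket x y)"
    and bracket_alternating: "x \<in> L \<Longrightarrow> bracket x x = 0"
    and jacobi: "\<lbrakk>x \<in> L; y \<in> L; z \<in> L\<rbrakk> \<Longrightarrow>
      bracket x (bracket y z) + bracket y (bracket z x) + bracket z (bracket x y) = 0"

definition lie_iso ::
  "('f \<Rightarrow> 'v::ab_group_add \<Rightarrow> 'v) \<Rightarrow> 'v set \<Rightarrow> ('v \<Rightarrow> 'v \<Rightarrow> 'v) \<Rightarrow>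
   ('f \<Rightarrow> 'w::ab_group_add \<Rightarrow> 'w) \<Rightarrow> 'w set \<Rightarrow> ('w \<Rightarrow> 'w \<Rightarrow> 'w) \<Rightarrow> ('v \<Rightarrow> 'w) \<Rightarrow> bool"
where
  "lie_iso scale\<^sub>1 L\<^sub>1 br\<^sub>1 scale\<^sub>2 L\<^sub>2 br\<^sub>2 \<phi> \<longleftrightarrow>
     bij_betw \<phi> L\<^sub>1 L\<^sub>2 \<and>
     (\<forall>x\<in>L\<^sub>1. \<forall>y\<in>L\<^sub>1. \<phi> (x + y) = \<phi> x + \<phi> y) \<and>
     (\<forall>c. \<forall>x\<in>L\<^sub>1. \<phi> (scale\<^sub>1 c x) = scale\<^sub>2 c (\<phi> x)) \<and>
     (\<forall>x\<in>L\<^sub>1. \<forall>y\<in>L\<^sub>1. \<phi> (br\<^sub>1 x y) = br\<^sub>2 (\<phi> x) (\<phi> y))"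

definition lie_isomorphic ::
  "('f \<Rightarrow> 'v::ab_group_add \<Rightarrow> 'v) \<Rightarrow> 'v set \<Rightarrow> ('v \<Rightarrow> 'v \<Rightarrow> 'v) \<Rightarrow>
   ('f \<Rightarrow> 'w::ab_group_add \<Rightarrow> 'w) \<Rightarrow> 'w set \<Rightarrow> ('w \<Rightarrow> 'w \<Rightarrow> 'w) \<Rightarrow> bool"
where
  "lie_isomorphic scale\<^sub>1 L\<^sub>1 br\<^sub>1 scale\<^sub>2 L\<^sub>2 br\<^sub>2 \<longleftrightarrow>
     (\<exists>\<phi>. lie_iso scale\<^sub>1 L\<^sub>1 br\<^sub>1 scale\<^sub>2 L\<^sub>2 br\<^sub>2 \<phi>)"

definition lie_aut_group ::
  "('f \<Rightarrow> 'v::ab_group_add \<Rightarrow> 'v) \<Rightarrow> ('v \<Rightarrow> 'v \<Rightarrow> 'v) \<Rightarrow> ('v \<Rightarrow> 'v) monoid"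
where
  "lie_aut_group scale br =
     \<lparr>carrier = {\<sigma>. lie_iso scale UNIV br scale UNIV br \<sigma>}, monoid.mult = (\<circ>), one = id\<rparr>"

definition twisted_der ::
  "('f::field \<Rightarrow> 'v::ab_group_add \<Rightarrow> 'v) \<Rightarrow> ('v \<Rightarrow> 'v \<Rightarrow> 'v) \<Rightarrow> ('v \<Rightarrow> 'v) \<Rightarrow> ('v \<Rightarrow> 'v) \<Rightarrow>
   ('v \<Rightarrow> 'v) set"
where
  "twisted_der scale br \<sigma> \<tau> =
     {D. Vector_Spaces.linear scale scale D \<and>
         (\<forall>x y. D (br x y) = br (D x) (\<sigma> y) + br (\<tau> x) (D y))}"

abbreviation lie_der ::
  "('f::field \<Rightarrow> 'v::ab_group_add \<Rightarrow> 'v) \<Rightarrow> ('v \<Rightarrow> 'v \<Rightarrow> 'v) \<Rightarrow> ('v \<Rightarrow> 'v) set"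
where
  "lie_der scale br \<equiv> twisted_der scale br id id"

text \<open>The vector space structure on maps is pointwise; its addition is the one of
  \<^theory>\<open>HOL-Library.Function_Algebras\<close>.\<close>

definition fun_scale :: "('f \<Rightarrow> 'v \<Rightarrow> 'v) \<Rightarrow> 'f \<Rightarrow> ('a \<Rightarrow> 'v) \<Rightarrow> 'a \<Rightarrow> 'v" where
  "fun_scale scale c D = (\<lambda>x. scale c (D x))"

definition commutator :: "('v::ab_group_add \<Rightarrow> 'v) \<Rightarrow> ('v \<Rightarrow> 'v) \<Rightarrow> 'v \<Rightarrow> 'v" where
  "commutator D T = (D \<circ> T) - (T \<circ> D)"

lemma vector_space_fun_scale:
  assumes "vector_space scale"
  shows "vector_space (fun_scale scale :: 'f::field \<Rightarrow> ('a \<Rightarrow> 'v::ab_group_add) \<Rightarrow> 'a \<Rightarrow> 'v)"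
proof -
  interpret vector_space scale by fact
  show ?thesis
    by unfold_locales (auto simp: fun_scale_def fun_eq_iff scale_right_distrib scale_left_distrib)
qed

context
  fixes scale :: "'f::field \<Rightarrow> 'v::ab_group_add \<Rightarrow> 'v" and br
  assumes lie: "lie_algebra scale UNIV br"
begin

interpretation lie_algebra scale UNIV br by (rule lie)

interpretation V: vector_space "fun_scale scale :: 'f \<Rightarrow> ('v \<Rightarrow> 'v) \<Rightarrow> 'v \<Rightarrow> 'v"
  by (rule vector_space_fun_scale) unfold_locales

lemma br_zero [simp]: "br 0 y = 0" "br x 0 = 0"
  using bracket_scale_left[of 0 y 0] bracket_scale_right[of x 0 0] by auto

lemma br_diff: "br (x - y) z = br x z - br y z" "br x (y - z) = br x y - br x z"
  using bracket_add_left[of "x - y" y z] bracket_add_right[of x "y - z" z]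
  by (auto simp: algebra_simps)

lemma group_lie_aut_group: "group (lie_aut_group scale br)"
proof (rule groupI)
  fix \<sigma> assume "\<sigma> \<in> carrier (lie_aut_group scale br)"
  then have \<sigma>: "lie_iso scale UNIV br scale UNIV br \<sigma>" by (simp add: lie_aut_group_def)
  then have b: "bij \<sigma>" by (simp add: lie_iso_def)
  then have s: "inv_into UNIV \<sigma> z = w \<longleftrightarrow> z = \<sigma> w" "\<sigma> (inv_into UNIV \<sigma> z) = z" for z w
    by (auto simp: bij_is_surj surj_f_inv_f bij_is_inj)
  from \<sigma> b have "lie_iso scale UNIV br scale UNIV br (inv_into UNIV \<sigma>)"
    by (simp add: lie_iso_def bij_imp_bij_inv s)
  moreover have "inv_into UNIV \<sigma> \<circ> \<sigma> = id" using b by (simp add: bij_is_inj)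
  ultimately show "\<exists>\<tau>\<in>carrier (lie_aut_group scale br).
      \<tau> \<otimes>\<^bsub>lie_aut_group scale br\<^esub> \<sigma> = \<one>\<^bsub>lie_aut_group scale br\<^esub>"
    by (auto simp: lie_aut_group_def)
qed (auto simp: lie_aut_group_def lie_iso_def bij_comp o_assoc)

lemma subspace_twisted_der:
  "module.subspace (fun_scale scale) (twisted_der scale br \<sigma> \<tau>)"
proof -
  interpret P: vector_space_pair scale scale by unfold_locales
  show ?thesis
    by (rule V.subspaceI)
      (auto simp: twisted_der_def fun_scale_def zero_fun_def plus_fun_def
        bracket_add_left bracket_add_right bracket_scale_left bracket_scale_right
        scale_right_distrib P.linear_zero intro: P.linear_compose_add P.linear_compose_scale_right)
qed

lemma lie_algebra_lie_der: "lie_algebra (fun_scale scale) (lie_der scale br) commutator"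
proof -
  interpret P: vector_space_pair scale scale by unfold_locales
  have add: "D (x + y) = D x + D y" and diff: "D (x - y) = D x - D y"
    and scl: "D (scale c x) = scale c (D x)" and lin: "Vector_Spaces.linear scale scale D"
    and der: "D (br x y) = br (D x) y + br x (D y)"
    if "D \<in> lie_der scale br" for D x y c
    using that P.linear_add P.linear_diff P.linear_scale by (auto simp: twisted_der_def)
  have closed: "commutator D T \<in> lie_der scale br"
    if "D \<in> lie_der scale br" "T \<in> lie_der scale br" for D T
  proof -
    have "Vector_Spaces.linear scale scale (commutator D T)"
      using P.linear_compose_sub[OF
          Vector_Spaces.linear_compose[OF lin[OF that(2)] lin[OF that(1)]]
          Vector_Spaces.linear_compose[OF lin[OF that(1)] lin[OF that(2)]]]
      by (simp add: commutator_def fun_diff_def comp_def)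
    moreover have "commutator D T (br x y) = br (commutator D T x) y + br x (commutator D T y)"
      for x y
      by (simp add: commutator_def der[OF that(1)] der[OF that(2)] add[OF that(1)] add[OF that(2)]
          br_diff algebra_simps)
    ultimately show ?thesis by (simp add: twisted_der_def)
  qed
  have app: "commutator D T x = D (T x) - T (D x)" for D T :: "'v \<Rightarrow> 'v" and x
    by (simp add: commutator_def)
  show ?thesis
    by unfold_locales
      (simp_all add: subspace_twisted_der closed app fun_scale_def fun_eq_iff
        add diff scl scale_right_diff_distrib)
qed

end

end

theory Submission
  imports Defs
begin

text \<open>If \<open>\<sigma>\<close> is an automorphism, composing the twisted Leibniz rule
  \<open>D [x, y] = [D x, \<sigma> y] + [\<sigma> x, D y]\<close> with \<open>\<sigma>\<inverse>\<close> removes the twist, because \<open>\<sigma>\<inverse>\<close> respects the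
  bracket: \<open>\<sigma>\<inverse> \<circ> D\<close> is an ordinary derivation. Conversely \<open>\<sigma> \<circ> E\<close> is a \<open>(\<sigma>, \<sigma>)\<close>-derivation for
  every derivation \<open>E\<close>. So \<open>D \<mapsto> \<sigma>\<inverse> \<circ> D\<close> is a linear bijection from the \<open>(\<sigma>, \<sigma>)\<close>-derivations onto
  the derivations (\<open>bij_betw_untwist\<close>). The commutator is then pulled back along this
  bijection (\<open>lie_algebra_transport\<close>), which becomes an isomorphism by construction; explicitly,
  \<open>[D, T]\<^sub>\<sigma> = D \<circ> \<sigma>\<inverse> \<circ> T - T \<circ> \<sigma>\<inverse> \<circ> D\<close>.\<close>

text \<open>Transport of structure. Every Lie algebra axiom is an identity between elements of \<open>L\<^sub>1\<close>, so
  by injectivity it may be checked after applying \<open>\<phi>\<close>, where it is the same axiom in \<open>L\<^sub>2\<close>.\<close>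

lemma lie_algebra_transport:
  fixes scale\<^sub>1 :: "'f::field \<Rightarrow> 'v::ab_group_add \<Rightarrow> 'v"
    and scale\<^sub>2 :: "'f \<Rightarrow> 'w::ab_group_add \<Rightarrow> 'w"
  assumes "vector_space scale\<^sub>1" and sub: "module.subspace scale\<^sub>1 L\<^sub>1"
    and "lie_algebra scale\<^sub>2 L\<^sub>2 br\<^sub>2"
    and bij: "bij_betw \<phi> L\<^sub>1 L\<^sub>2"
    and add: "\<And>x y. x \<in> L\<^sub>1 \<Longrightarrow> y \<in> L\<^sub>1 \<Longrightarrow> \<phi> (x + y) = \<phi> x + \<phi> y"
    and scl: "\<And>c x. x \<in> L\<^sub>1 \<Longrightarrow> \<phi> (scale\<^sub>1 c x) = scale\<^sub>2 c (\<phi> x)"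
  shows "\<exists>br\<^sub>1. lie_algebra scale\<^sub>1 L\<^sub>1 br\<^sub>1 \<and> lie_iso scale\<^sub>1 L\<^sub>1 br\<^sub>1 scale\<^sub>2 L\<^sub>2 br\<^sub>2 \<phi>"
proof -
  interpret V: vector_space scale\<^sub>1 by fact
  interpret W: lie_algebra scale\<^sub>2 L\<^sub>2 br\<^sub>2 by fact
  define br\<^sub>1 where "br\<^sub>1 x y = inv_into L\<^sub>1 \<phi> (br\<^sub>2 (\<phi> x) (\<phi> y))" for x y
  have \<phi>_in: "\<phi> x \<in> L\<^sub>2" if "x \<in> L\<^sub>1" for x
    using bij that by (auto simp: bij_betw_def)
  have \<phi>_eq: "x = y" if "\<phi> x = \<phi> y" "x \<in> L\<^sub>1" "y \<in> L\<^sub>1" for x y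
    using bij that by (auto simp: bij_betw_def inj_on_def)
  have br_in: "br\<^sub>1 x y \<in> L\<^sub>1" if "x \<in> L\<^sub>1" "y \<in> L\<^sub>1" for x y
    using W.bracket_closed[OF \<phi>_in[OF that(1)] \<phi>_in[OF that(2)]] bij
    unfolding br\<^sub>1_def by (metis bij_betw_def inv_into_into)
  have \<phi>_br: "\<phi> (br\<^sub>1 x y) = br\<^sub>2 (\<phi> x) (\<phi> y)" if "x \<in> L\<^sub>1" "y \<in> L\<^sub>1" for x y
    using W.bracket_closed[OF \<phi>_in[OF that(1)] \<phi>_in[OF that(2)]] bij
    unfolding br\<^sub>1_def by (metis bij_betw_inv_into_right)
  note closed = V.subspace_0[OF sub] V.subspace_add[OF sub] V.subspace_scale[OF sub] br_in
  have \<phi>_0: "\<phi> 0 = 0"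
    using add[of 0 0] closed(1) by simp
  have "lie_algebra scale\<^sub>1 L\<^sub>1 br\<^sub>1"
    by unfold_locales
      (auto intro!: sub br_in \<phi>_eq simp: closed add scl \<phi>_br \<phi>_0 \<phi>_in W.bracket_add_left
        W.bracket_add_right W.bracket_scale_left W.bracket_scale_right W.bracket_alternating
        W.jacobi)
  moreover have "lie_iso scale\<^sub>1 L\<^sub>1 br\<^sub>1 scale\<^sub>2 L\<^sub>2 br\<^sub>2 \<phi>"
    by (simp add: lie_iso_def bij add scl \<phi>_br)
  ultimately show ?thesis by blast
qed

text \<open>Composing with an automorphism on the left multiplies both twists by it. Applied to \<open>\<sigma>\<inverse>\<close>
  and \<open>\<sigma>\<close>, this gives the two directions of the bijection below.\<close>

lemma twisted_der_comp_left:
  assumes "vector_space scale" and "lie_iso scale UNIV br scale UNIV br \<rho>"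
    and "D \<in> twisted_der scale br \<sigma> \<tau>"
  shows "\<rho> \<circ> D \<in> twisted_der scale br (\<rho> \<circ> \<sigma>) (\<rho> \<circ> \<tau>)"
proof -
  interpret vector_space scale by fact
  interpret P: vector_space_pair scale scale by unfold_locales
  have "Vector_Spaces.linear scale scale \<rho>"
    using assms(2) by unfold_locales (auto simp: lie_iso_def)
  then have "Vector_Spaces.linear scale scale (\<rho> \<circ> D)"
    using assms(3) by (auto simp: twisted_der_def intro: Vector_Spaces.linear_compose)
  then show ?thesis
    using assms(2,3) by (simp add: twisted_der_def lie_iso_def)
qed

lemma bij_betw_untwist:
  assumes lie: "lie_algebra scale UNIV br"
    and aut: "\<sigma> \<in> carrier (lie_aut_group scale br)"
  shows "bij_betw (\<lambda>D. inv_into UNIV \<sigma> \<circ> D) (twisted_der scale br \<sigma> \<sigma>) (lie_der scale br)"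
proof -
  interpret lie_algebra scale UNIV br by (rule lie)
  interpret A: group "lie_aut_group scale br" by (rule group_lie_aut_group[OF lie])
  have \<sigma>: "lie_iso scale UNIV br scale UNIV br \<sigma>"
    using aut by (simp add: lie_aut_group_def)
  then have "bij \<sigma>" by (simp add: lie_iso_def)
  then have inverse: "inv_into UNIV \<sigma> \<circ> \<sigma> = id" "\<sigma> \<circ> inv_into UNIV \<sigma> = id"
    by (simp_all add: bij_is_inj bij_is_surj flip: surj_iff)
  \<comment> \<open>The inverse in the automorphism group is the inverse map, hence again an automorphism.\<close>
  obtain \<rho> where \<rho>: "lie_iso scale UNIV br scale UNIV br \<rho>" "\<rho> \<circ> \<sigma> = id"
    using A.l_inv_ex[OF aut] by (auto simp: lie_aut_group_def)
  then have "\<rho> = inv_into UNIV \<sigma>"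
    by (metis comp_assoc comp_id id_comp inverse(2))
  with \<rho> have inv_\<sigma>: "lie_iso scale UNIV br scale UNIV br (inv_into UNIV \<sigma>)" by simp
  show ?thesis
  proof (rule bij_betw_byWitness[where f' = "\<lambda>E. \<sigma> \<circ> E"])
    show "(\<lambda>D. inv_into UNIV \<sigma> \<circ> D) ` twisted_der scale br \<sigma> \<sigma> \<subseteq> lie_der scale br"
      using twisted_der_comp_left[OF vector_space_axioms inv_\<sigma>, of _ \<sigma> \<sigma>] by (auto simp: inverse)
    show "(\<lambda>E. \<sigma> \<circ> E) ` lie_der scale br \<subseteq> twisted_der scale br \<sigma> \<sigma>"
      using twisted_der_comp_left[OF vector_space_axioms \<sigma>, of _ id id] by auto
  qed (simp_all add: inverse flip: comp_assoc)
qed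

theorem theorem1p3:
  fixes scale :: "'f::{alg_closed_field, field_char_0} \<Rightarrow> 'v::ab_group_add \<Rightarrow> 'v"
    and Basis :: "'v set"
    and br :: "'v \<Rightarrow> 'v \<Rightarrow> 'v"
    and G :: "('v \<Rightarrow> 'v) set"
    and \<sigma> :: "'v \<Rightarrow> 'v"
  assumes "finite_dimensional_vector_space scale Basis"
    and "lie_algebra scale UNIV br"
    and "subgroup G (lie_aut_group scale br)"
    and "\<sigma> \<in> G"
  shows "\<exists>br\<^sub>\<sigma>. lie_algebra (fun_scale scale) (twisted_der scale br \<sigma> \<sigma>) br\<^sub>\<sigma> \<and>
    lie_isomorphic (fun_scale scale) (twisted_der scale br \<sigma> \<sigma>) br\<^sub>\<sigma>
      (fun_scale scale) (lie_der scale br) commutator"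
proof -
  interpret lie_algebra scale UNIV br by fact
  have aut: "\<sigma> \<in> carrier (lie_aut_group scale br)"
    using assms(3,4) by (rule subgroup.mem_carrier)
  then have \<sigma>: "bij \<sigma>" "\<And>x y. \<sigma> (x + y) = \<sigma> x + \<sigma> y" "\<And>c x. \<sigma> (scale c x) = scale c (\<sigma> x)"
    by (auto simp: lie_aut_group_def lie_iso_def)
  then have \<sigma>_inv: "\<sigma> (inv_into UNIV \<sigma> x) = x" "inv_into UNIV \<sigma> (\<sigma> x) = x" for x
    by (simp_all add: bij_is_inj bij_is_surj surj_f_inv_f)
  have "inv_into UNIV \<sigma> (x + y) = inv_into UNIV \<sigma> x + inv_into UNIV \<sigma> y"
    "inv_into UNIV \<sigma> (scale c x) = scale c (inv_into UNIV \<sigma> x)" for x y c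
    by (metis \<sigma>(2) \<sigma>_inv, metis \<sigma>(3) \<sigma>_inv)
  then have "\<exists>br\<^sub>\<sigma>. lie_algebra (fun_scale scale) (twisted_der scale br \<sigma> \<sigma>) br\<^sub>\<sigma> \<and>
      lie_iso (fun_scale scale) (twisted_der scale br \<sigma> \<sigma>) br\<^sub>\<sigma>
        (fun_scale scale) (lie_der scale br) commutator (\<lambda>D. inv_into UNIV \<sigma> \<circ> D)"
    by (intro lie_algebra_transport vector_space_fun_scale vector_space_axioms
        subspace_twisted_der lie_algebra_lie_der assms(2) bij_betw_untwist aut)
      (simp_all add: fun_eq_iff fun_scale_def)
  then show ?thesis
    unfolding lie_isomorphic_def by blast
qed

end
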